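(* Let $V$ be a finite-dimensional vector space and $\mathcal{X}=(X_1,\dots,X_n)$ a family of subspaces of $V$. A subspace $T\le V$ is a partial $q$-transversal of $\mathcal{X}$ if and only if for every $J\subseteq\{1,\dots,n\}$, \[ \dim\bigl(T\cap\mathcal{X}(J)\bigr)+|J|\le n. \]
   Context: $\mathcal{X}(J)=\bigcap_{j\in J}X_j$, with the convention $\mathcal{X}(\emptyset)=V$. A partial $q$-transversal of $\mathcal{X}$ is a subspace $T\le V$ such that every vector basis $B$ of $T$ admits an injection $\pi:B\to\{1,\dots,n\}$ with $b\notin X_{\pi(b)}$ for all $b\in B$. *)

theory Defs
  imports Complex_Main
begin

text \<open>The ambient space $V$ is the whole carrier type, so the intersection
  over the empty index set is \<^term>\<open>UNIV\<close>, i.e. $V$.\<close>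

definition family_Inter :: "(nat \<Rightarrow> 'v set) \<Rightarrow> nat set \<Rightarrow> 'v set" where
  "family_Inter X J = (\<Inter>j\<in>J. X j)"

definition basis_of ::
    "('k::field \<Rightarrow> 'v::ab_group_add \<Rightarrow> 'v) \<Rightarrow> 'v set \<Rightarrow> 'v set \<Rightarrow> bool" where
  "basis_of scale B T \<longleftrightarrow>
     B \<subseteq> T \<and> \<not> module.dependent scale B \<and> module.span scale B = T"

definition partial_q_transversal ::
    "('k::field \<Rightarrow> 'v::ab_group_add \<Rightarrow> 'v) \<Rightarrow> nat \<Rightarrow> (nat \<Rightarrow> 'v set) \<Rightarrow> 'v set \<Rightarrow> bool" where
  "partial_q_transversal scale n X T \<longleftrightarrow>
     module.subspace scale T \<and>
     (\<forall>B. basis_of scale B T \<longrightarrow>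
        (\<exists>\<pi>. inj_on \<pi> B \<and> \<pi> ` B \<subseteq> {1..n} \<and> (\<forall>b\<in>B. b \<notin> X (\<pi> b))))"

end

theory Submission
  imports Defs
begin

text \<open>
  For a basis \<open>B\<close> of \<open>T\<close>, an admissible injection is a system of distinct representatives of the
  sets \<open>N b = {i. b \<notin> X i}\<close>. A set \<open>S \<subseteq> B\<close> misses exactly the indices \<open>J = {i. S \<subseteq> X i}\<close>, and then
  \<open>S\<close> is independent in \<open>T \<inter> X(J)\<close>, so the dimension bound for \<open>J\<close> is Hall's condition for \<open>S\<close>.
  Conversely, extend a basis \<open>C\<close> of \<open>T \<inter> X(J)\<close> to one of \<open>T\<close>: the injection maps \<open>C\<close> outside \<open>J\<close>.
\<close>

text \<open>The proof of Halmos and Vaughan: split at a critical subset (one where Hall's condition is an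
  equality) if there is one, and otherwise represent one element arbitrarily.\<close>

theorem Hall_marriage:
  assumes "finite A" and "\<And>a. a \<in> A \<Longrightarrow> finite (N a)"
    and "\<And>S. S \<subseteq> A \<Longrightarrow> card S \<le> card (\<Union>(N ` S))"
  shows "\<exists>f. inj_on f A \<and> (\<forall>a\<in>A. f a \<in> N a)"
  using assms
proof (induction "card A" arbitrary: A N rule: less_induct)
  case less
  note fin = \<open>finite A\<close> and finN = less.prems(2) and Hall = less.prems(3)
  show ?case
  proof (cases "\<exists>C. C \<subset> A \<and> C \<noteq> {} \<and> card C = card (\<Union>(N ` C))")
    case True
    then obtain C where C: "C \<subset> A" "C \<noteq> {}" "card C = card (\<Union>(N ` C))" by blast
    have finC: "finite C" using C fin by (meson finite_subset psubset_imp_subset)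
    let ?U = "\<Union>(N ` C)"
    have "\<exists>f. inj_on f C \<and> (\<forall>a\<in>C. f a \<in> N a)"
    proof (rule less.hyps)
      show "card C < card A" using C(1) fin by (rule psubset_card_mono[rotated])
      show "card S \<le> card (\<Union>(N ` S))" if "S \<subseteq> C" for S
        using that C(1) by (intro Hall) auto
    qed (use C(1) finN finC in auto)
    then obtain f where f: "inj_on f C" "\<forall>a\<in>C. f a \<in> N a" by blast
    \<comment> \<open>Deleting \<open>?U\<close> keeps the choices on \<open>A - C\<close> from
      colliding with those on \<open>C\<close>. Hall's condition survives: apply the original one to
      \<open>S \<union> C\<close> and cancel \<open>card C = card ?U\<close>.\<close>
    have "\<exists>g. inj_on g (A - C) \<and> (\<forall>a\<in>A - C. g a \<in> N a - ?U)"
    proof (rule less.hyps)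
      show "card (A - C) < card A"
        using C fin by (intro psubset_card_mono) auto
    next
      fix S assume S: "S \<subseteq> A - C"
      have finS: "finite S" using S fin finite_subset by blast
      have eq: "\<Union>(N ` (S \<union> C)) = (\<Union>a\<in>S. N a - ?U) \<union> ?U" by blast
      have "card S + card C = card (S \<union> C)"
        using S finS finC by (intro card_Un_disjoint[symmetric]) auto
      also have "\<dots> \<le> card (\<Union>(N ` (S \<union> C)))"
        using S C by (intro Hall) auto
      also have "\<dots> \<le> card (\<Union>a\<in>S. N a - ?U) + card ?U"
        unfolding eq by (rule card_Un_le)
      finally show "card S \<le> card (\<Union>a\<in>S. N a - ?U)" using C by simp
    qed (use fin finN in auto)
    then obtain g where g: "inj_on g (A - C)" "\<forall>a\<in>A - C. g a \<in> N a - ?U" by blast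
    define h where "h a = (if a \<in> C then f a else g a)" for a
    have "inj_on h A"
    proof -
      have "f ` C \<subseteq> ?U" using f(2) by (intro image_subsetI UN_I) auto
      moreover have "g ` (A - C) \<subseteq> - ?U"
      proof (rule image_subsetI)
        fix a assume "a \<in> A - C"
        with g(2) have "g a \<in> N a - ?U" by (rule bspec)
        then show "g a \<in> - ?U" by simp
      qed
      ultimately have "f ` C \<inter> g ` (A - C) = {}" by auto
      then have "inj_on h (C \<union> (A - C))"
        unfolding h_def using f(1) g(1) by (intro inj_on_disjoint_Un) auto
      then show ?thesis using C(1) by (simp add: Un_absorb1 psubset_imp_subset)
    qed
    moreover have "\<forall>a\<in>A. h a \<in> N a" using f g unfolding h_def by auto
    ultimately show ?thesis by blast
  next
    case False
    show ?thesis
    proof (cases "A = {}")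
      case False
      then obtain a where a: "a \<in> A" by blast
      have "card {a} \<le> card (\<Union>(N ` {a}))" using a by (intro Hall) auto
      then have "N a \<noteq> {}" by auto
      then obtain x where x: "x \<in> N a" by blast
      \<comment> \<open>With \<open>x\<close> reserved for \<open>a\<close>, each union loses at
        most one element, so it is enough that the original inequality is strict for nonempty
        \<open>S\<close>.\<close>
      have "\<exists>g. inj_on g (A - {a}) \<and> (\<forall>b\<in>A - {a}. g b \<in> N b - {x})"
      proof (rule less.hyps)
        show "card (A - {a}) < card A" using a fin by (rule card_Diff1_less[rotated])
      next
        fix S assume S: "S \<subseteq> A - {a}"
        have eq: "(\<Union>b\<in>S. N b - {x}) = \<Union>(N ` S) - {x}" by blast
        show "card S \<le> card (\<Union>b\<in>S. N b - {x})"
        proof (cases "S = {}")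
          case False
          \<comment> \<open>As \<open>S\<close> omits \<open>a\<close>, it is a nonempty proper
            subset of \<open>A\<close>, and in this case no such set is critical.\<close>
          have "card S \<noteq> card (\<Union>(N ` S))"
            using \<open>\<nexists>C. C \<subset> A \<and> C \<noteq> {} \<and> card C = card (\<Union>(N ` C))\<close> S a False by blast
          moreover have "card S \<le> card (\<Union>(N ` S))" using S by (intro Hall) auto
          moreover have "card (\<Union>(N ` S)) - 1 \<le> card (\<Union>(N ` S) - {x})"
            by (simp add: card_Diff_singleton_if)
          ultimately show ?thesis unfolding eq by linarith
        qed simp
      qed (use fin finN in auto)
      then obtain g where g: "inj_on g (A - {a})" "\<forall>b\<in>A - {a}. g b \<in> N b - {x}" by blast
      have "inj_on (g(a := x)) A"
        using g by (subst insert_Diff[OF a, symmetric]) (auto simp: inj_on_def)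
      moreover have "\<forall>b\<in>A. (g(a := x)) b \<in> N b" using g x by auto
      ultimately show ?thesis by blast
    qed simp
  qed
qed

theorem theorem18:
  fixes scale :: "'k::field \<Rightarrow> 'v::ab_group_add \<Rightarrow> 'v"
    and Basis :: "'v set"
    and n :: nat
    and X :: "nat \<Rightarrow> 'v set"
    and T :: "'v set"
  assumes "finite_dimensional_vector_space scale Basis"
    and "\<forall>i\<in>{1..n}. module.subspace scale (X i)"
    and "module.subspace scale T"
  shows "partial_q_transversal scale n X T \<longleftrightarrow>
    (\<forall>J. J \<subseteq> {1..n} \<longrightarrow> vector_space.dim scale (T \<inter> family_Inter X J) + card J \<le> n)"
proof -
  interpret finite_dimensional_vector_space scale Basis by fact
  show ?thesis
  proof (intro iffI allI impI)
    fix J assume T: "partial_q_transversal scale n X T" and J: "J \<subseteq> {1..n}"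
    let ?W = "T \<inter> family_Inter X J"
    obtain C where C: "C \<subseteq> ?W" "independent C" "card C = dim ?W"
      using basis_exists by metis
    \<comment> \<open>\<open>B\<close> is a maximal independent subset of \<open>T\<close>
      containing \<open>C\<close>; maximality makes it span \<open>T\<close>.\<close>
    obtain B where B: "C \<subseteq> B" "B \<subseteq> T" "independent B" "T \<subseteq> span B"
      using maximal_independent_subset_extend[of C T] C by auto
    have "basis_of scale B T"
      unfolding basis_of_def using B span_minimal[OF \<open>B \<subseteq> T\<close> assms(3)] by auto
    then obtain \<pi> where \<pi>: "inj_on \<pi> B" "\<pi> ` B \<subseteq> {1..n}" "\<forall>b\<in>B. b \<notin> X (\<pi> b)"
      using T unfolding partial_q_transversal_def by blast
    \<comment> \<open>A vector of \<open>C\<close> lies in every \<open>X j\<close> with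
      \<open>j \<in> J\<close>, so \<open>\<pi>\<close> cannot send it to such a
      \<open>j\<close>.\<close>
    have "\<pi> ` C \<inter> J = {}"
      using C(1) B(1) \<pi>(3) unfolding family_Inter_def by blast
    moreover have "finite (\<pi> ` C)" "finite J"
      using C(2) finiteI_independent J finite_subset by auto
    ultimately have "card (\<pi> ` C) + card J = card (\<pi> ` C \<union> J)"
      by (simp add: card_Un_disjoint)
    also have "\<dots> \<le> card {1..n}"
      using \<pi>(2) B(1) J by (intro card_mono) auto
    finally show "dim ?W + card J \<le> n"
      using C(3) card_image[OF inj_on_subset[OF \<pi>(1) B(1)]] by simp
  next
    assume bound: "\<forall>J. J \<subseteq> {1..n} \<longrightarrow> dim (T \<inter> family_Inter X J) + card J \<le> n"
    show "partial_q_transversal scale n X T"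
      unfolding partial_q_transversal_def
    proof (intro conjI allI impI)
      show "subspace T" by fact
    next
      fix B assume "basis_of scale B T"
      then have B: "B \<subseteq> T" "independent B" unfolding basis_of_def by auto
      define N where "N b = {i \<in> {1..n}. b \<notin> X i}" for b
      have "\<exists>\<pi>. inj_on \<pi> B \<and> (\<forall>b\<in>B. \<pi> b \<in> N b)"
      proof (rule Hall_marriage)
        show "finite B" using B finiteI_independent by blast
        show "finite (N b)" for b unfolding N_def by simp
      next
        fix S assume S: "S \<subseteq> B"
        \<comment> \<open>The largest index set with \<open>S \<subseteq> family_Inter X J\<close>;
          its complement in \<open>{1..n}\<close> is the union of the sets \<open>N b\<close> over
          \<open>b \<in> S\<close>. If \<open>J\<close> is empty, the intersection is the whole
          space and only \<open>S \<subseteq> T\<close> matters.\<close>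
        define J where "J = {i \<in> {1..n}. S \<subseteq> X i}"
        have "card S \<le> dim (T \<inter> family_Inter X J)"
          using S B independent_mono
          by (intro independent_card_le_dim) (auto simp: family_Inter_def J_def)
        moreover have "dim (T \<inter> family_Inter X J) + card J \<le> n"
          by (rule bound[rule_format]) (auto simp: J_def)
        moreover have "\<Union>(N ` S) = {1..n} - J" unfolding N_def J_def by auto
        \<comment> \<open>The bound for \<open>J\<close> gives
          \<open>card S + card J \<le> n\<close>, so the truncated subtraction is harmless.\<close>
        moreover have "card ({1..n} - J) = n - card J"
          unfolding J_def by (subst card_Diff_subset) auto
        ultimately show "card S \<le> card (\<Union>(N ` S))" by simp
      qed
      then show "\<exists>\<pi>. inj_on \<pi> B \<and> \<pi> ` B \<subseteq> {1..n} \<and> (\<forall>b\<in>B. b \<notin> X (\<pi> b))"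
        unfolding N_def by blast
    qed
  qed
qed

end
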